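(* Let $S$ be a numerical semigroup. Then: (a) $\mathrm{Betti}(S)$ is totally ordered by $\le_S$ (i.e. $S$ is Betti-sorted) if and only if $\mathcal E(S)$ is totally ordered by $\le_S$; (b) $\mathrm{Betti}(S)$ is totally ordered by divisibility in $\mathbb N$ (i.e. $S$ is Betti-divisible) if and only if $\mathcal E(S)$ is totally ordered by divisibility; (c) $S$ has exactly one Betti element if and only if $\mathcal E(S)$ is a singleton.
   Context: A numerical semigroup $S$ is a submonoid of $(\mathbb N,+)$ with finite complement; $A$ denotes its minimal generating set $\{n_1,\dots,n_e\}$. The cyclotomic exponent sequence $(e_j)_{j\ge1}$ is the unique integer sequence with $(1-x)\sum_{s\in S}x^s=\prod_{j\ge1}(1-x^j)^{e_j}$ in $\mathbb Z[[x]]$, and $\mathcal E(S)=\{d\in\mathbb N: d\ge2,\ e_d\neq0,\ d\notin A\}$. Write $a\le_S b$ if $b-a\in S$. With $\varphi:\mathbb N^e\to S$, $\varphi(a)=\sum_i a_in_i$, let $\mathrm Z(s)=\varphi^{-1}(s)$; $\nabla_s$ is the graph on $\mathrm Z(s)$ where distinct $x,y$ are adjacent iff $x\cdot y\ne0$. $s\in S$ is a Betti element if $\nabla_s$ is disconnected; $\mathrm{Betti}(S)$ is the set of Betti elements. *)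

theory Defs
  imports "HOL-Computational_Algebra.Formal_Power_Series"
begin

definition numerical_semigroup :: "nat set \<Rightarrow> bool" where
  "numerical_semigroup S \<longleftrightarrow> 0 \<in> S \<and> (\<forall>a\<in>S. \<forall>b\<in>S. a + b \<in> S) \<and> finite (UNIV - S)"

definition min_gens :: "nat set \<Rightarrow> nat set" where
  "min_gens S = {a \<in> S. a \<noteq> 0 \<and> \<not> (\<exists>b\<in>S. \<exists>c\<in>S. b \<noteq> 0 \<and> c \<noteq> 0 \<and> a = b + c)}"

text \<open>Hilbert series sum over s in S of x^s (rational coefficients; Z[[x]] embeds in Q[[x]]).\<close>
definition hilb :: "nat set \<Rightarrow> rat fps" where
  "hilb S = Abs_fps (\<lambda>n. if n \<in> S then 1 else 0)"

text \<open>e is a cyclotomic exponent sequence (indexed by j \<ge> 1; e 0 fixed to 0) iff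
  (1 - x) H_S(x) = prod_{j\<ge>1} (1 - x^j)^(e j) in the x-adic sense: for every n the
  coefficients up to degree n agree with the finite product over j = 1..n
  (factors with j > n are congruent to 1 modulo x^(n+1)).\<close>
definition is_cyc_exp :: "nat set \<Rightarrow> (nat \<Rightarrow> int) \<Rightarrow> bool" where
  "is_cyc_exp S e \<longleftrightarrow> e 0 = 0 \<and>
     (\<forall>n. \<forall>k\<le>n. fps_nth ((1 - fps_X) * hilb S) k =
                 fps_nth (\<Prod>j\<in>{1..n}. (1 - fps_X ^ j) powi (e j)) k)"

definition cyc_exp :: "nat set \<Rightarrow> nat \<Rightarrow> int" where
  "cyc_exp S = (THE e. is_cyc_exp S e)"

definition calE :: "nat set \<Rightarrow> nat set" where
  "calE S = {d. d \<ge> 2 \<and> cyc_exp S d \<noteq> 0 \<and> d \<notin> min_gens S}"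

definition le_S :: "nat set \<Rightarrow> nat \<Rightarrow> nat \<Rightarrow> bool" where
  "le_S S a b \<longleftrightarrow> (\<exists>c\<in>S. b = a + c)"

definition factorizations :: "nat set \<Rightarrow> nat \<Rightarrow> (nat \<Rightarrow> nat) set" where
  "factorizations S s = {x. (\<forall>a. a \<notin> min_gens S \<longrightarrow> x a = 0) \<and>
                           (\<Sum>a\<in>min_gens S. x a * a) = s}"

definition nabla_adj :: "nat set \<Rightarrow> nat \<Rightarrow> (nat \<Rightarrow> nat) \<Rightarrow> (nat \<Rightarrow> nat) \<Rightarrow> bool" where
  "nabla_adj S s x y \<longleftrightarrow> x \<in> factorizations S s \<and> y \<in> factorizations S s \<and> x \<noteq> y \<and>
     (\<Sum>a\<in>min_gens S. x a * y a) \<noteq> 0"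

definition nabla_connected :: "nat set \<Rightarrow> nat \<Rightarrow> bool" where
  "nabla_connected S s \<longleftrightarrow>
     (\<forall>x\<in>factorizations S s. \<forall>y\<in>factorizations S s. (nabla_adj S s)\<^sup>*\<^sup>* x y)"

definition Betti :: "nat set \<Rightarrow> nat set" where
  "Betti S = {s \<in> S. \<not> nabla_connected S s}"

definition totally_ordered_by :: "(nat \<Rightarrow> nat \<Rightarrow> bool) \<Rightarrow> nat set \<Rightarrow> bool" where
  "totally_ordered_by R X \<longleftrightarrow> (\<forall>a\<in>X. \<forall>b\<in>X. R a b \<or> R b a)"

end

theory Submission
  imports Defs "HOL-Library.Function_Algebras" "HOL-Library.Confluence"
begin

text \<open>
  The point is local: if the Betti elements below \<open>s\<close> form a \<open>\<le>\<^sub>S\<close>-chain, then for \<open>s \<ge> 2\<close> not a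
  generator, \<open>e\<^sub>s\<close> counts a set of factorizations of \<open>s\<close> that is nonempty iff \<open>s\<close> is a Betti element.
  For every Betti element \<open>b \<le>\<^sub>S s\<close> fix a base factorization, and let \<open>B\<close> be the set of all
  factorizations of such \<open>b\<close> outside the component of the base. The chain condition forces the members
  of \<open>B\<close> to have pairwise disjoint supports. Hence replacing \<open>\<beta> \<in> B\<close> by the base of its degree is a
  confluent and terminating rewriting, and it identifies all factorizations of each \<open>t \<le>\<^sub>S s\<close>; so each
  such \<open>t\<close> has exactly one factorization that contains no member of \<open>B\<close>.

  By disjointness of supports, the generating function of the factorizations avoiding \<open>B\<close> is
  \<open>\<Prod>\<^sub>\<beta> (1 - X^|\<beta>|) / \<Prod>\<^sub>a (1 - X^a)\<close>, with \<open>a\<close> ranging over the generators, and it agrees with the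
  Hilbert series of \<open>S\<close> except in the degrees of the ideal of elements of \<open>S\<close> not below \<open>s\<close>. A product
  of powers of \<open>1 - X^j\<close> lying in \<open>1 + I\<close> for an additively closed set \<open>I\<close> of degrees has all its exponents
  indexed by \<open>I\<close>, so the cyclotomic exponents outside the ideal can be read off.

  Thus \<open>\<E>(S) = Betti(S)\<close> when \<open>Betti(S)\<close> is a chain. If it is not, an incomparable pair of Betti
  elements with least maximum has only chains below both members, so both of them lie in \<open>\<E>(S)\<close>.
\<close>

unbundle fps_syntax

section \<open>Products of powers of 1 - X^j\<close>

text \<open>For additively closed \<open>J\<close> these series form a group under multiplication,
  so membership passes to products and integer powers.\<close>

definition one_plus :: "nat set \<Rightarrow> rat fps set" where
  "one_plus J = {f. f $ 0 = 1 \<and> (\<forall>k>0. f $ k \<noteq> 0 \<longrightarrow> k \<in> J)}"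

definition tprod :: "(nat \<Rightarrow> int) \<Rightarrow> nat \<Rightarrow> rat fps" where
  "tprod g n = (\<Prod>j\<in>{1..n}. (1 - fps_X ^ j) powi (g j))"

lemma X_power_dvd_iff:
  "fps_X ^ Suc n dvd (f :: rat fps) \<longleftrightarrow> (\<forall>k\<le>n. f $ k = 0)"
proof
  assume "fps_X ^ Suc n dvd f"
  then obtain g where "f = fps_X ^ Suc n * g" by (auto simp: dvd_def)
  then show "\<forall>k\<le>n. f $ k = 0" by (simp only: fps_X_power_mult_nth) simp
next
  assume f: "\<forall>k\<le>n. f $ k = 0"
  have "f = fps_X ^ Suc n * fps_shift (Suc n) f"
    by (rule fps_ext) (use f in \<open>simp only: fps_X_power_mult_nth, auto\<close>)
  then show "fps_X ^ Suc n dvd f" by (metis dvd_triv_left)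
qed

lemma one_plusD: "f \<in> one_plus J \<Longrightarrow> f $ k \<noteq> 0 \<Longrightarrow> k > 0 \<Longrightarrow> k \<in> J"
  by (auto simp: one_plus_def)

lemma one_plus_nth_0: "f \<in> one_plus J \<Longrightarrow> f $ 0 = 1"
  by (auto simp: one_plus_def)

lemma one_plus_1: "1 \<in> one_plus J"
  by (auto simp: one_plus_def)

lemma fps_mult_nth_nonzeroE:
  fixes f g :: "rat fps"
  assumes "(f * g) $ k \<noteq> 0"
  obtains i where "i \<le> k" "f $ i \<noteq> 0" "g $ (k - i) \<noteq> 0"
proof -
  have "(\<Sum>i=0..k. f $ i * g $ (k - i)) \<noteq> 0"
    using assms by (simp add: fps_mult_nth)
  then obtain i where "i \<in> {0..k}" "f $ i * g $ (k - i) \<noteq> 0"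
    by (rule sum.not_neutral_contains_not_neutral)
  then show ?thesis using that by auto
qed

lemma one_plus_mult:
  assumes "\<And>i j. i \<in> J \<Longrightarrow> j \<in> J \<Longrightarrow> i + j \<in> J" and f: "f \<in> one_plus J" and g: "g \<in> one_plus J"
  shows "f * g \<in> one_plus J"
proof -
  have "k \<in> J" if k: "k > 0" "(f * g) $ k \<noteq> 0" for k
  proof -
    obtain i where i: "i \<le> k" "f $ i \<noteq> 0" "g $ (k - i) \<noteq> 0"
      using k(2) by (rule fps_mult_nth_nonzeroE)
    then have "i > 0 \<Longrightarrow> i \<in> J" "k - i > 0 \<Longrightarrow> k - i \<in> J"
      using one_plusD[OF f] one_plusD[OF g] by auto
    then show ?thesis
      using assms(1)[of i "k - i"] i(1) k(1) by (cases "i = 0"; cases "i = k") auto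
  qed
  then show ?thesis
    using f g by (auto simp: one_plus_def)
qed

text \<open>Comparing degree \<open>k\<close> in \<open>inverse f * f = 1\<close> expresses
  \<open>inverse f $ k\<close> by products of an earlier coefficient of the inverse and one of
  \<open>f\<close>; strong induction puts both degrees in \<open>J\<close> (or the first is
  0).\<close>

lemma one_plus_inverse:
  assumes J: "\<And>i j. i \<in> J \<Longrightarrow> j \<in> J \<Longrightarrow> i + j \<in> J" and f: "f \<in> one_plus J"
  shows "inverse f \<in> one_plus J"
proof -
  have f0: "f $ 0 = 1" using f by (rule one_plus_nth_0)
  have inv: "inverse f * f = 1" by (rule inverse_mult_eq_1) (simp add: f0)
  have "k \<in> J" if "k > 0" "inverse f $ k \<noteq> 0" for k
    using that
  proof (induction k rule: less_induct)
    case (less k)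
    have "0 = (inverse f * f) $ k" using less.prems inv by simp
    also have "\<dots> = (\<Sum>i=0..k. inverse f $ i * f $ (k - i))" by (rule fps_mult_nth)
    also have "\<dots> = inverse f $ k + (\<Sum>i\<in>{0..<k}. inverse f $ i * f $ (k - i))"
      by (simp add: f0 atLeastLessThanSuc_atLeastAtMost[symmetric])
    finally have "(\<Sum>i\<in>{0..<k}. inverse f $ i * f $ (k - i)) \<noteq> 0"
      using less.prems by auto
    then obtain i where i: "i < k" "inverse f $ i * f $ (k - i) \<noteq> 0"
      by (auto elim: sum.not_neutral_contains_not_neutral)
    have "k - i \<in> J" using one_plusD[OF f, of "k - i"] i by auto
    then show ?case using i less.IH[of i] J[of i "k - i"] by (cases "i = 0") auto
  qed
  then show ?thesis by (auto simp: one_plus_def f0)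
qed

lemma one_plus_prod:
  assumes "\<And>i j. i \<in> J \<Longrightarrow> j \<in> J \<Longrightarrow> i + j \<in> J" and "\<And>x. x \<in> X \<Longrightarrow> f x \<in> one_plus J"
  shows "prod f X \<in> one_plus J"
  using assms(2)
  by (induction X rule: infinite_finite_induct) (auto intro: one_plus_1 one_plus_mult[OF assms(1)])

lemma one_plus_powi:
  assumes "\<And>i j. i \<in> J \<Longrightarrow> j \<in> J \<Longrightarrow> i + j \<in> J" and f: "f \<in> one_plus J"
  shows "f powi k \<in> one_plus J"
proof -
  have "h ^ n \<in> one_plus J" if "h \<in> one_plus J" for h n
    using that by (induction n) (auto intro: one_plus_1 one_plus_mult[OF assms(1)])
  then show ?thesis
    using f one_plus_inverse[OF assms] by (auto simp: power_int_def)
qed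

lemma one_minus_X_power_one_plus: "j \<in> J \<Longrightarrow> j > 0 \<Longrightarrow> 1 - fps_X ^ j \<in> one_plus J"
  by (auto simp: one_plus_def)

section \<open>Coefficients and exponents of truncated products\<close>

lemma fps_powi_add:
  assumes "f $ 0 = (1 :: rat)"
  shows "f powi (k + l) = f powi k * f powi l"
proof -
  \<comment> \<open>\<open>rat fps\<close> is not a field; the exponent law rests on the constant
    term 1, which makes \<open>f\<close> a unit.\<close>
  have inv: "f * inverse f = 1" by (metis assms inverse_mult_eq_1' one_neq_zero)
  have canc: "f ^ (a + b) * inverse f ^ b = f ^ a" "inverse f ^ (a + b) * f ^ b = inverse f ^ a" for a b
    using inv by (simp_all add: power_add mult.assoc mult.commute flip: power_mult_distrib)
  have aux: "f powi (int a - int b) = f ^ a * inverse f ^ b" for a b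
  proof (cases "b \<le> a")
    case True
    then show ?thesis using canc(1)[of "a - b" b] by (simp add: power_int_def nat_diff_distrib flip: of_nat_diff)
  next
    case False
    then have "a \<le> b" "\<not> int a - int b \<ge> 0" "nat (- (int a - int b)) = b - a" by auto
    then show ?thesis using canc(2)[of "b - a" a] by (simp add: power_int_def mult.commute)
  qed
  obtain a b c d where "k = int a - int b" "l = int c - int d"
    by (metis int_diff_cases)
  moreover have "int a - int b + (int c - int d) = int (a + c) - int (b + d)" by simp
  ultimately show ?thesis by (simp only: aux power_add ac_simps)
qed

lemma tprod_add: "tprod (\<lambda>j. g j + h j) n = tprod g n * tprod h n"
  unfolding tprod_def prod.distrib[symmetric]
  by (rule prod.cong) (auto intro!: fps_powi_add)

lemma tprod_Suc: "tprod g (Suc n) = tprod g n * (1 - fps_X ^ Suc n) powi g (Suc n)"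
  by (simp add: tprod_def)

text \<open>Modulo \<open>X^(n+1)\<close> the power is \<open>1 - k X^n\<close>: one more factor
  adds the error \<open>k X^(2n)\<close>, which vanishes because \<open>2n >= n+1\<close>.\<close>

lemma powi_nth_same:
  assumes "n > 0"
  shows "((1 - fps_X ^ n :: rat fps) powi k) $ n = - of_int k"
    and "0 < i \<Longrightarrow> i < n \<Longrightarrow> ((1 - fps_X ^ n :: rat fps) powi k) $ i = 0"
    and "((1 - fps_X ^ n :: rat fps) powi k) $ 0 = 1"
proof -
  let ?u = "1 - fps_X ^ n :: rat fps"
  define P where "P k \<longleftrightarrow> fps_X ^ Suc n dvd (?u powi k - (1 - fps_const (of_int k) * fps_X ^ n))" for k
  have u0: "?u $ 0 = 1" using assms by simp
  have XX: "fps_X ^ Suc n dvd fps_const c * (fps_X ^ n * fps_X ^ n :: rat fps)" for c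
  proof -
    have "Suc n \<le> n + n" using assms by simp
    then show ?thesis unfolding power_add[symmetric] by (intro dvd_mult le_imp_power_dvd)
  qed
  have P0: "P 0" by (simp add: P_def)
  \<comment> \<open>An equivalence, since multiplying by the unit \<open>?u\<close> preserves and
    reflects divisibility; so the induction also reaches negative exponents.\<close>
  have step: "P k \<longleftrightarrow> P (k + 1)" for k
  proof -
    have "?u powi (k + 1) = ?u powi k * ?u" using fps_powi_add[OF u0, of k 1] by simp
    then have "?u powi (k + 1) - (1 - fps_const (of_int (k + 1)) * fps_X ^ n)
      = (?u powi k - (1 - fps_const (of_int k) * fps_X ^ n)) * ?u
        + fps_const (of_int k) * (fps_X ^ n * fps_X ^ n)"
      by (simp add: algebra_simps flip: fps_const_add)
    then have "P (k + 1) \<longleftrightarrow> fps_X ^ Suc n dvd (?u powi k - (1 - fps_const (of_int k) * fps_X ^ n)) * ?u"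
      by (simp only: P_def dvd_add_left_iff[OF XX])
    also have "\<dots> \<longleftrightarrow> P k"
      unfolding P_def using u0 by (intro dvd_mult_unit_iff) simp
    finally show ?thesis by simp
  qed
  have "P k"
    by (induction k rule: int_induct[where k = 0]) (use P0 step step[of "_ - 1"] in auto)
  then have *: "\<forall>i\<le>n. (?u powi k) $ i = (1 - fps_const (of_int k) * fps_X ^ n) $ i"
    unfolding P_def X_power_dvd_iff by simp
  show "(?u powi k) $ n = - of_int k" "0 < i \<Longrightarrow> i < n \<Longrightarrow> (?u powi k) $ i = 0" "(?u powi k) $ 0 = 1"
    using * assms by auto
qed

lemma tprod_nth_0: "tprod g n $ 0 = 1"
  by (induction n) (auto simp: tprod_Suc powi_nth_same simp del: power_Suc, simp add: tprod_def)

lemma fps_mult_gap_nth: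
  assumes "\<And>i. 0 < i \<Longrightarrow> i < n \<Longrightarrow> (g :: rat fps) $ i = 0" "g $ 0 = 1" "n > 0"
  shows "k < n \<Longrightarrow> (f * g) $ k = f $ k" "(f * g) $ n = f $ n + f $ 0 * g $ n"
proof -
  have *: "(f * g) $ k = f $ k + (\<Sum>i\<in>{0..<k}. f $ i * g $ (k - i))" for k
    by (simp add: fps_mult_nth assms(2) atLeastLessThanSuc_atLeastAtMost[symmetric])
  show "(f * g) $ k = f $ k" if "k < n"
    unfolding * using that assms(1) by (auto intro!: sum.neutral)
  have "(\<Sum>i\<in>{0..<n}. f $ i * g $ (n - i)) = f $ 0 * g $ n + (\<Sum>i\<in>{1..<n}. f $ i * g $ (n - i))"
    using assms(3) by (simp add: sum.atLeast_Suc_lessThan)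
  also have "(\<Sum>i\<in>{1..<n}. f $ i * g $ (n - i)) = 0"
    using assms(1) by (intro sum.neutral) auto
  finally show "(f * g) $ n = f $ n + f $ 0 * g $ n" unfolding * by simp
qed

text \<open>Below degree \<open>n + 2\<close> the new factor is \<open>1 - g(n+1) X^(n+1)\<close>,
  so each exponent can be read off from one coefficient once the earlier exponents are
  known.\<close>

lemma tprod_Suc_nth:
  "k \<le> n \<Longrightarrow> tprod g (Suc n) $ k = tprod g n $ k"
  "tprod g (Suc n) $ Suc n = tprod g n $ Suc n - of_int (g (Suc n))"
proof -
  have *: "0 < i \<Longrightarrow> i < Suc n \<Longrightarrow> ((1 - fps_X ^ Suc n :: rat fps) powi g (Suc n)) $ i = 0"
    "((1 - fps_X ^ Suc n :: rat fps) powi g (Suc n)) $ 0 = 1" for i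
    by (rule powi_nth_same; simp)+
  note ** = fps_mult_gap_nth[OF *(1) *(2) zero_less_Suc, where f = "tprod g n"]
  show "k \<le> n \<Longrightarrow> tprod g (Suc n) $ k = tprod g n $ k"
    unfolding tprod_Suc using **(1)[where k = k] by simp
  show "tprod g (Suc n) $ Suc n = tprod g n $ Suc n - of_int (g (Suc n))"
    unfolding tprod_Suc using **(2) powi_nth_same(1)[of "Suc n" "g (Suc n)"]
    by (simp add: tprod_nth_0 del: power_Suc)
qed

lemma tprod_nth_le: "k \<le> m \<Longrightarrow> m \<le> n \<Longrightarrow> tprod g n $ k = tprod g m $ k"
  by (rotate_tac 1, induction n rule: dec_induct) (auto simp: tprod_Suc_nth(1) simp del: power_Suc)

text \<open>If all nonzero exponents before \<open>j\<close> are indexed by \<open>J\<close>, the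
  product of those factors lies in \<open>one_plus J\<close>. In degree \<open>j\<close> it differs
  from \<open>F\<close> by \<open>g j\<close>, so one of the two has a nonzero coefficient
  there.\<close>

lemma tprod_exponents_in:
  assumes J: "\<And>i j. i \<in> J \<Longrightarrow> j \<in> J \<Longrightarrow> i + j \<in> J" and F: "F \<in> one_plus J"
    and eq: "\<And>k. k \<le> n \<Longrightarrow> tprod g n $ k = F $ k" and j: "1 \<le> j" "j \<le> n" "g j \<noteq> 0"
  shows "j \<in> J"
  using j
proof (induction j rule: less_induct)
  case (less j)
  obtain m where m: "j = Suc m" using less.prems by (cases j) auto
  have "tprod g m \<in> one_plus J"
    unfolding tprod_def
  proof (rule one_plus_prod[OF J])
    fix i assume "i \<in> {1..m}"
    then show "(1 - fps_X ^ i) powi g i \<in> one_plus J"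
      using less m by (cases "g i = 0")
        (auto intro!: one_plus_powi[OF J] one_minus_X_power_one_plus one_plus_1)
  qed
  moreover have "F $ j = tprod g m $ j - of_int (g j)"
    using eq[of j] tprod_nth_le[of j j n g] less.prems m tprod_Suc_nth(2)[of g m] by simp
  then have "F $ j \<noteq> 0 \<or> tprod g m $ j \<noteq> 0"
    using less.prems by auto
  ultimately show ?case
    using one_plusD[OF F, of j] one_plusD[of "tprod g m" J j] less.prems by auto
qed

text \<open>Greedy construction: the exponent at \<open>n + 1\<close> is the discrepancy between the
  product so far and \<open>F\<close> in that degree. Integrality of all coefficients makes the
  floors exact.\<close>

lemma tprod_exponents_ex1:
  fixes F :: "rat fps"
  assumes F0: "F $ 0 = 1" and F: "\<And>k. F $ k \<in> \<int>"
  shows "\<exists>!e. e 0 = 0 \<and> (\<forall>n. \<forall>k\<le>n. F $ k = tprod e n $ k)"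
proof -
  define P where "P = rec_nat 1 (\<lambda>n p. p * (1 - fps_X ^ Suc n) powi \<lfloor>(p $ Suc n - F $ Suc n)\<rfloor>)"
  define e where "e n = (case n of 0 \<Rightarrow> 0 | Suc m \<Rightarrow> \<lfloor>P m $ n - F $ n\<rfloor>)" for n
  have P: "P n = tprod e n" for n
    by (induction n) (simp_all add: P_def e_def tprod_Suc del: power_Suc, simp add: tprod_def)
  have sat: "(\<forall>k\<le>n. F $ k = tprod e n $ k) \<and> (\<forall>k. tprod e n $ k \<in> \<int>)" for n
  proof (induction n)
    case 0
    then show ?case using F0 by (simp add: tprod_def)
  next
    case (Suc n)
    have Ints_mult: "(\<forall>k. (f * g) $ k \<in> \<int>)" if "\<forall>k. f $ k \<in> \<int>" "\<forall>k. g $ k \<in> \<int>" for f g :: "rat fps"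
      using that by (auto simp: fps_mult_nth)
    have Ints_pow: "(\<forall>k. (f ^ m) $ k \<in> \<int>)" if "\<forall>k. f $ k \<in> \<int>" for f :: "rat fps" and m
      using that by (induction m) (auto intro!: Ints_mult[rule_format])
    let ?u = "1 - fps_X ^ Suc n :: rat fps"
    \<comment> \<open>The geometric series is integral, so negative powers of \<open>?u\<close> are
      too.\<close>
    have "inverse ?u = Abs_fps (\<lambda>k. if Suc n dvd k then 1 else 0)"
    proof (rule fps_inverse_unique, rule fps_ext)
      fix k
      have "Suc n dvd k \<longleftrightarrow> k = 0" if "k < Suc n"
        using that nat_dvd_not_less by auto
      then show "(?u * Abs_fps (\<lambda>k. if Suc n dvd k then 1 else 0)) $ k = 1 $ k"
        by (cases "k < Suc n")
          (auto simp: left_diff_distrib fps_X_power_mult_nth dvd_minus_self simp del: power_Suc)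
    qed
    then have "\<forall>k. (?u powi e (Suc n)) $ k \<in> \<int>"
      by (auto simp: power_int_def simp del: power_Suc intro!: Ints_pow[rule_format])
    then have ints: "\<forall>k. tprod e (Suc n) $ k \<in> \<int>"
      unfolding tprod_Suc using Suc by (intro Ints_mult) auto
    have "of_int (e (Suc n)) = tprod e n $ Suc n - F $ Suc n"
    proof -
      have "tprod e n $ Suc n - F $ Suc n \<in> \<int>" using Suc F by auto
      then show ?thesis by (auto simp: e_def P elim!: Ints_cases)
    qed
    then have "\<forall>k\<le>Suc n. F $ k = tprod e (Suc n) $ k"
      using Suc tprod_Suc_nth[where g = e and n = n] by (auto simp: le_Suc_eq)
    with ints show ?case by blast
  qed
  show ?thesis
  proof (rule ex1I[of _ e])
    show "e 0 = 0 \<and> (\<forall>n. \<forall>k\<le>n. F $ k = tprod e n $ k)"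
      using sat by (auto simp: e_def)
  next
    fix e' assume e': "e' 0 = 0 \<and> (\<forall>n. \<forall>k\<le>n. F $ k = tprod e' n $ k)"
    have "e' n = e n" for n
    proof (induction n rule: less_induct)
      case (less n)
      show ?case
      proof (cases n)
        case 0
        then show ?thesis using e' by (simp add: e_def)
      next
        case (Suc m)
        have "tprod e' m = tprod e m"
          unfolding tprod_def using less Suc by (intro prod.cong) auto
        moreover have "F $ n = tprod e' n $ n" "F $ n = tprod e n $ n"
          using e' sat by auto
        ultimately show ?thesis
          using tprod_Suc_nth(2)[of e m] tprod_Suc_nth(2)[of e' m] Suc by simp
      qed
    qed
    then show "e' = e" ..
  qed
qed

section \<open>Factorizations and Betti elements\<close>

definition disjoint_supp :: "(nat \<Rightarrow> nat) \<Rightarrow> (nat \<Rightarrow> nat) \<Rightarrow> bool" where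
  "disjoint_supp x y \<longleftrightarrow> (\<forall>a. x a = 0 \<or> y a = 0)"

definition unit_vec :: "nat \<Rightarrow> nat \<Rightarrow> nat" where
  "unit_vec a = (\<lambda>c. if c = a then 1 else 0)"

lemma disjoint_supp_sym: "disjoint_supp x y \<longleftrightarrow> disjoint_supp y x"
  unfolding disjoint_supp_def by (metis (no_types))

lemma le_fun_iff_add: "\<beta> \<le> x \<longleftrightarrow> (\<exists>v. x = v + \<beta>)" for x \<beta> :: "nat \<Rightarrow> nat"
proof
  assume "\<beta> \<le> x"
  then have "x = (\<lambda>a. x a - \<beta> a) + \<beta>" by (auto simp: le_fun_def)
  then show "\<exists>v. x = v + \<beta>" by (rule exI[where x = "\<lambda>a. x a - \<beta> a"])
qed (auto simp: le_fun_def)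

text \<open>Resolves overlaps in the rewriting below: where \<open>y\<close> is nonzero
  \<open>x\<close> vanishes, so \<open>y\<close> is contained in \<open>v\<close>, and the witness
  \<open>v - y\<close> loses nothing by truncation.\<close>

lemma disjoint_supp_add:
  assumes "disjoint_supp x y" "v + x = w + (y :: nat \<Rightarrow> nat)"
  obtains u where "v = u + y" "w = u + x"
proof
  have eq: "v a + x a = w a + y a" for a using fun_cong[OF assms(2)] by simp
  have d: "x a = 0 \<or> y a = 0" for a using assms(1) by (simp add: disjoint_supp_def)
  show "v = (\<lambda>a. v a - y a) + y"
  proof
    fix a show "v a = ((\<lambda>a. v a - y a) + y) a" using eq[of a] d[of a] by auto
  qed
  show "w = (\<lambda>a. v a - y a) + x"
  proof
    fix a show "w a = ((\<lambda>a. v a - y a) + x) a" using eq[of a] d[of a] by auto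
  qed
qed

locale numerical_sgp =
  fixes S :: "nat set"
  assumes numerical_semigroup: "numerical_semigroup S"
begin

abbreviation "A \<equiv> min_gens S"
abbreviation "Z \<equiv> factorizations S"

definition wt :: "(nat \<Rightarrow> nat) \<Rightarrow> nat" where
  "wt x = (\<Sum>a\<in>A. x a * a)"

definition Fac :: "(nat \<Rightarrow> nat) set" where
  "Fac = {x. \<forall>a. a \<notin> A \<longrightarrow> x a = 0}"

lemma zero_in: "0 \<in> S" and add_in: "a \<in> S \<Longrightarrow> b \<in> S \<Longrightarrow> a + b \<in> S"
  and finite_gaps: "finite (UNIV - S)"
  using numerical_semigroup by (auto simp: numerical_semigroup_def)

lemma Z_iff: "x \<in> Z t \<longleftrightarrow> x \<in> Fac \<and> wt x = t"
  by (auto simp: factorizations_def Fac_def wt_def)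

lemma A_subset: "a \<in> A \<Longrightarrow> a \<in> S" and A_pos: "a \<in> A \<Longrightarrow> 0 < a"
  by (auto simp: min_gens_def)

lemma finite_A: "finite A"
proof -
  obtain c where c: "\<And>n. n \<notin> S \<Longrightarrow> n < c"
    using finite_gaps unfolding finite_nat_set_iff_bounded by auto
  \<comment> \<open>All gaps lie below \<open>c\<close>, so a larger \<open>a\<close> splits as
    \<open>c + 1\<close> plus a remainder that is also beyond the gaps.\<close>
  have "a \<le> 2 * c + 1" if "a \<in> A" for a
  proof (rule ccontr)
    assume "\<not> a \<le> 2 * c + 1"
    then have "\<not> c + 1 < c" "\<not> a - (c + 1) < c" "a = (c + 1) + (a - (c + 1))" "a - (c + 1) \<noteq> 0"
      by auto
    then have "c + 1 \<in> S" "a - (c + 1) \<in> S" "a = (c + 1) + (a - (c + 1))" "a - (c + 1) \<noteq> 0"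
      using c[of "c + 1"] c[of "a - (c + 1)"] by auto
    then show False using that unfolding min_gens_def by fastforce
  qed
  then show ?thesis by (meson finite_nat_set_iff_bounded_le)
qed

lemma wt_add: "wt (x + y) = wt x + wt y"
  by (simp add: wt_def sum.distrib algebra_simps)

lemma Fac_add_iff: "x + y \<in> Fac \<longleftrightarrow> x \<in> Fac \<and> y \<in> Fac"
  by (auto simp: Fac_def)

lemma wt_unit_vec: "a \<in> A \<Longrightarrow> wt (unit_vec a) = a"
  by (simp add: wt_def unit_vec_def finite_A if_distrib[of "\<lambda>z. z * _"] sum.delta cong: if_cong)

lemma unit_vec_Fac: "a \<in> A \<Longrightarrow> unit_vec a \<in> Fac"
  by (auto simp: Fac_def unit_vec_def)

lemma zero_Fac: "0 \<in> Fac" and wt_zero: "wt 0 = 0"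
  by (auto simp: Fac_def wt_def)

lemma Z_add: "x \<in> Z t \<Longrightarrow> y \<in> Z u \<Longrightarrow> x + y \<in> Z (t + u)"
  by (simp add: Z_iff wt_add Fac_add_iff)

lemma coord_le_wt: "x \<in> Fac \<Longrightarrow> x a * a \<le> wt x"
  using member_le_sum[of a A "\<lambda>a. x a * a"] finite_A
  by (cases "a \<in> A") (auto simp: wt_def Fac_def)

lemma wt_eq_0: "x \<in> Fac \<Longrightarrow> wt x = 0 \<longleftrightarrow> x = 0"
  using finite_A A_pos by (auto simp: wt_def Fac_def fun_eq_iff)

lemma finite_Z: "finite (Z t)"
proof (rule finite_subset)
  show "Z t \<subseteq> {f. \<forall>x. (x \<in> A \<longrightarrow> f x \<in> {..t}) \<and> (x \<notin> A \<longrightarrow> f x = 0)}"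
  proof (intro subsetI CollectI allI conjI impI)
    fix f a assume f: "f \<in> Z t" "a \<in> A"
    then have "f a * a \<le> t" "a > 0" using coord_le_wt[of f a] A_pos by (auto simp: Z_iff)
    then show "f a \<in> {..t}" by (metis atMost_iff le_trans mult.right_neutral mult_le_mono2 Suc_leI One_nat_def)
  qed (auto simp: Z_iff Fac_def)
  show "finite {f. \<forall>x. (x \<in> A \<longrightarrow> f x \<in> {..t}) \<and> (x \<notin> A \<longrightarrow> f x = 0)}"
    by (intro finite_set_of_finite_funs finite_A) simp
qed

lemma wt_in_S: "wt x \<in> S"
proof -
  have "(\<Sum>a\<in>X. x a * a) \<in> S" if "X \<subseteq> A" for X
    using finite_subset[OF that finite_A] that
  proof (induction X)
    case (insert a X)
    have "n * a \<in> S" for n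
      using insert.prems A_subset by (induction n) (auto intro: zero_in add_in)
    then show ?case using insert by (auto intro: add_in)
  qed (simp add: zero_in)
  then show ?thesis by (simp add: wt_def)
qed

lemma Z_in_S: "x \<in> Z t \<Longrightarrow> t \<in> S"
  using wt_in_S[of x] by (simp add: Z_iff)

lemma Z_nonempty: "s \<in> S \<Longrightarrow> \<exists>x. x \<in> Z s"
proof (induction s rule: less_induct)
  case (less s)
  consider "s = 0" | "s \<in> A" | b c where "b \<in> S" "c \<in> S" "b \<noteq> 0" "c \<noteq> 0" "s = b + c"
    using less.prems by (auto simp: min_gens_def)
  then show ?case
  proof cases
    case 1
    then show ?thesis unfolding Z_iff using zero_Fac wt_zero by blast
  next
    case 2
    then show ?thesis by (intro exI[of _ "unit_vec s"]) (simp add: Z_iff unit_vec_Fac wt_unit_vec)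
  next
    case 3
    then obtain x y where "x \<in> Z b" "y \<in> Z c" using less.IH[of b] less.IH[of c] by auto
    then show ?thesis using 3 Z_add by blast
  qed
qed

lemma le_S_refl: "le_S S a a"
  using zero_in by (auto simp: le_S_def)

lemma le_S_trans: "le_S S a b \<Longrightarrow> le_S S b c \<Longrightarrow> le_S S a c"
  unfolding le_S_def by (metis add.assoc add_in)

lemma le_S_add: "c \<in> S \<Longrightarrow> le_S S a (a + c)"
  by (auto simp: le_S_def)

lemma le_S_imp_le: "le_S S a b \<Longrightarrow> a \<le> b"
  by (auto simp: le_S_def)

section \<open>The factorization graph and Betti elements\<close>

abbreviation "con t \<equiv> (nabla_adj S t)\<^sup>*\<^sup>*"

lemma nabla_adj_iff:
  "nabla_adj S t x y \<longleftrightarrow> x \<in> Z t \<and> y \<in> Z t \<and> x \<noteq> y \<and> \<not> disjoint_supp x y"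
  using finite_A by (auto simp: nabla_adj_def disjoint_supp_def Z_iff Fac_def)

lemma con_sym: "con t x y \<Longrightarrow> con t y x"
  by (rule sympD[OF symp_rtranclp]) (auto simp: symp_def nabla_adj_iff disjoint_supp_sym)

lemma con_share: "x \<in> Z t \<Longrightarrow> y \<in> Z t \<Longrightarrow> \<not> disjoint_supp x y \<Longrightarrow> con t x y"
  by (cases "x = y") (auto simp: nabla_adj_iff)

lemma con_Z: "con t x y \<Longrightarrow> x \<in> Z t \<Longrightarrow> y \<in> Z t"
  by (induction rule: rtranclp_induct) (auto simp: nabla_adj_iff)

lemma split_unit:
  assumes "x \<in> Z t" "x a \<noteq> 0"
  obtains t' x' where "t = t' + a" "x = x' + unit_vec a" "x' \<in> Z t'" "a \<in> A"
proof -
  have a: "a \<in> A" using assms by (auto simp: Z_iff Fac_def)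
  have "unit_vec a \<le> x" using assms(2) by (auto simp: le_fun_def unit_vec_def)
  then obtain x' where x': "x = x' + unit_vec a" by (auto simp: le_fun_iff_add)
  then have "t = wt x' + a" "x' \<in> Z (wt x')"
    using assms(1) by (auto simp: Z_iff wt_add wt_unit_vec a Fac_add_iff)
  with x' a that show ?thesis by blast
qed

lemma split_shared:
  assumes "x \<in> Z t" "y \<in> Z t" "\<not> disjoint_supp x y"
  obtains a t' x' y' where "t = t' + a" "x = x' + unit_vec a" "y = y' + unit_vec a"
    "x' \<in> Z t'" "y' \<in> Z t'" "a \<in> A" "t' < t"
proof -
  obtain a where a: "x a \<noteq> 0" "y a \<noteq> 0" using assms(3) by (auto simp: disjoint_supp_def)
  obtain t' x' where x: "t = t' + a" "x = x' + unit_vec a" "x' \<in> Z t'" "a \<in> A"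
    using split_unit[OF assms(1) a(1)] by blast
  obtain t'' y' where y: "t = t'' + a" "y = y' + unit_vec a" "y' \<in> Z t''"
    using split_unit[OF assms(2) a(2)] by blast
  show ?thesis using that[of t' a x' y'] x y A_pos[of a] by auto
qed

text \<open>If \<open>t\<close> is not a Betti element, \<open>x\<close> has a neighbour. Cancelling
  a shared generator leaves two distinct factorizations of a smaller element, and induction
  applies.\<close>

lemma Betti_below:
  assumes "x \<in> Z t" "y \<in> Z t" "x \<noteq> y"
  shows "\<exists>c\<in>Betti S. le_S S c t"
  using assms
proof (induction t arbitrary: x y rule: less_induct)
  case (less t)
  show ?case
  proof (cases "t \<in> Betti S")
    case True
    then show ?thesis using le_S_refl by blast
  next
    case False
    then have "con t x y"
      using less.prems Z_in_S by (auto simp: Betti_def nabla_connected_def)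
    then obtain x1 where "nabla_adj S t x x1"
      using less.prems by (metis converse_rtranclpE)
    then have "x1 \<in> Z t" "x \<noteq> x1" "\<not> disjoint_supp x x1" by (auto simp: nabla_adj_iff)
    then obtain a t' x' y' where *: "t = t' + a" "x = x' + unit_vec a" "x1 = y' + unit_vec a"
      "x' \<in> Z t'" "y' \<in> Z t'" "a \<in> A" "t' < t"
      using split_shared[OF less.prems(1)] by metis
    then have "x' \<noteq> y'" using \<open>x \<noteq> x1\<close> by auto
    then obtain c where "c \<in> Betti S" "le_S S c t'"
      using less.IH[of t' x' y'] * by blast
    then show ?thesis using *(1,6) le_S_trans le_S_add A_subset by blast
  qed
qed

lemma Betti_two:
  assumes "b \<in> Betti S"
  obtains x y where "x \<in> Z b" "y \<in> Z b" "x \<noteq> y" "\<not> con b x y"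
  using assms by (auto simp: Betti_def nabla_connected_def)

text \<open>Zero and each generator have a single factorization, so their graphs are
  connected.\<close>

lemma Betti_notin_A: "b \<in> Betti S \<Longrightarrow> b \<notin> A" and Betti_pos: "b \<in> Betti S \<Longrightarrow> 0 < b"
proof -
  assume "b \<in> Betti S"
  then obtain x y where xy: "x \<in> Z b" "y \<in> Z b" "x \<noteq> y" by (rule Betti_two)
  show "0 < b"
  proof (rule ccontr)
    assume "\<not> 0 < b"
    then have "x = 0" "y = 0" using xy wt_eq_0 by (auto simp: Z_iff)
    then show False using xy by simp
  qed
  show "b \<notin> A"
  proof
    assume b: "b \<in> A"
    have "z = unit_vec b" if z: "z \<in> Z b" for z
    proof -
      have "z \<noteq> 0" using z \<open>0 < b\<close> wt_zero by (auto simp: Z_iff)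
      then obtain a where "z a \<noteq> 0" by (auto simp: fun_eq_iff)
      then obtain t' z' where *: "b = t' + a" "z = z' + unit_vec a" "z' \<in> Z t'" "a \<in> A"
        using split_unit[OF z] by metis
      then have "t' = 0" using b Z_in_S[of z' t'] A_pos[of a] A_subset[of a]
        unfolding min_gens_def by blast
      then have "z' = 0" using * wt_eq_0[of z'] by (auto simp: Z_iff)
      then show ?thesis using * \<open>t' = 0\<close> by simp
    qed
    then show False using xy by metis
  qed
qed

lemma Betti_ge_2: "b \<in> Betti S \<Longrightarrow> 2 \<le> b"
proof (rule ccontr)
  assume b: "b \<in> Betti S" "\<not> 2 \<le> b"
  then have "b = 1" "b \<in> S" using Betti_pos[of b] by (auto simp: Betti_def)
  then have "b \<in> A" by (auto simp: min_gens_def)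
  then show False using b Betti_notin_A by blast
qed

section \<open>Generating functions of factorizations avoiding a set\<close>

definition avoiding :: "(nat \<Rightarrow> nat) set \<Rightarrow> nat \<Rightarrow> (nat \<Rightarrow> nat) set" where
  "avoiding B t = {x \<in> Z t. \<forall>\<beta>\<in>B. \<not> \<beta> \<le> x}"

definition avoid_series :: "(nat \<Rightarrow> nat) set \<Rightarrow> rat fps" where
  "avoid_series B = Abs_fps (\<lambda>t. of_nat (card (avoiding B t)))"

text \<open>The factorizations lost are those containing \<open>\<beta>\<close>. Removing
  \<open>\<beta>\<close> from them is a bijection onto \<open>avoiding B (t - wt \<beta>)\<close>,
  because by disjointness \<open>\<beta>\<close> does not affect whether a member of
  \<open>B\<close> is contained.\<close>

lemma avoid_series_insert:
  assumes "\<beta> \<in> Fac" "\<And>\<beta>'. \<beta>' \<in> B \<Longrightarrow> disjoint_supp \<beta> \<beta>'"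
  shows "avoid_series (insert \<beta> B) = avoid_series B * (1 - fps_X ^ wt \<beta>)"
proof (rule fps_ext)
  fix t
  let ?M = "{x \<in> avoiding B t. \<beta> \<le> x}"
  have fin: "finite (avoiding C u)" for C u
    unfolding avoiding_def using finite_Z by simp
  have "card (avoiding B t) = card (avoiding (insert \<beta> B) t) + card ?M"
    by (subst card_Un_disjoint[symmetric]) (auto simp: fin avoiding_def intro!: arg_cong[where f = card] finite_Z)
  moreover have "card ?M = (if t < wt \<beta> then 0 else card (avoiding B (t - wt \<beta>)))"
  proof (cases "t < wt \<beta>")
    case True
    then have M: "?M = {}" by (auto simp: avoiding_def Z_iff le_fun_iff_add wt_add)
    show ?thesis unfolding M using True by simp
  next
    case False
    have le_iff: "\<beta>' \<le> v + \<beta> \<longleftrightarrow> \<beta>' \<le> v" if "\<beta>' \<in> B" for \<beta>' v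
    proof -
      have "\<beta> a = 0 \<or> \<beta>' a = 0" for a using assms(2)[OF that] by (auto simp: disjoint_supp_def)
      then show ?thesis unfolding le_fun_def by (metis add.right_neutral le0 plus_fun_apply)
    qed
    have "?M = (\<lambda>v. v + \<beta>) ` avoiding B (t - wt \<beta>)"
      using False assms(1)
      by (auto simp: avoiding_def Z_iff wt_add Fac_add_iff le_iff le_fun_iff_add[of \<beta>] image_iff)
    moreover have "inj_on (\<lambda>v. v + \<beta>) X" for X by (auto simp: inj_on_def)
    ultimately show ?thesis using False by (simp add: card_image)
  qed
  ultimately show "avoid_series (insert \<beta> B) $ t = (avoid_series B * (1 - fps_X ^ wt \<beta>)) $ t"
    by (simp add: avoid_series_def right_diff_distrib fps_X_power_mult_right_nth)
qed

lemma avoid_series_prod: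
  assumes "finite B" "B \<subseteq> Fac" "\<And>\<beta> \<beta>'. \<beta> \<in> B \<Longrightarrow> \<beta>' \<in> B \<Longrightarrow> \<beta> \<noteq> \<beta>' \<Longrightarrow> disjoint_supp \<beta> \<beta>'"
  shows "avoid_series B = avoid_series {} * (\<Prod>\<beta>\<in>B. 1 - fps_X ^ wt \<beta>)"
  using assms
proof (induction B)
  case (insert \<beta> B)
  have "avoid_series (insert \<beta> B) = avoid_series B * (1 - fps_X ^ wt \<beta>)"
  proof (rule avoid_series_insert)
    show "\<beta> \<in> Fac" using insert.prems by simp
    show "disjoint_supp \<beta> \<beta>'" if "\<beta>' \<in> B" for \<beta>'
      using insert.prems(2)[of \<beta> \<beta>'] insert.hyps that by auto
  qed
  then show ?case using insert by (simp add: ac_simps)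
qed simp

text \<open>Taking the unit vectors as the avoided set leaves only the zero factorization, and the
  product formula turns this into \<open>1 / \<Prod>(1 - X^a)\<close> for the series of all
  factorizations.\<close>

lemma avoid_series_gens: "avoid_series {} * (\<Prod>a\<in>A. 1 - fps_X ^ a) = 1"
proof -
  have inj: "inj_on unit_vec A" by (auto simp: inj_on_def unit_vec_def fun_eq_iff split: if_splits)
  have "avoid_series (unit_vec ` A) = avoid_series {} * (\<Prod>\<beta>\<in>unit_vec ` A. 1 - fps_X ^ wt \<beta>)"
  proof (rule avoid_series_prod)
    show "disjoint_supp \<beta> \<beta>'" if "\<beta> \<in> unit_vec ` A" "\<beta>' \<in> unit_vec ` A" "\<beta> \<noteq> \<beta>'" for \<beta> \<beta>'
      using that by (auto simp: disjoint_supp_def unit_vec_def split: if_splits)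
  qed (auto simp: finite_A unit_vec_Fac)
  also have "(\<Prod>\<beta>\<in>unit_vec ` A. 1 - fps_X ^ wt \<beta> :: rat fps) = (\<Prod>a\<in>A. 1 - fps_X ^ a)"
    by (simp add: prod.reindex[OF inj] wt_unit_vec)
  finally have "avoid_series (unit_vec ` A) = avoid_series {} * (\<Prod>a\<in>A. 1 - fps_X ^ a)" .
  moreover have "avoid_series (unit_vec ` A) = 1"
  proof (rule fps_ext)
    fix t
    have "unit_vec a \<le> x \<longleftrightarrow> x a \<noteq> 0" for a and x :: "nat \<Rightarrow> nat"
      by (auto simp: le_fun_def unit_vec_def)
    then have "x \<in> avoiding (unit_vec ` A) t \<longleftrightarrow> x \<in> Z t \<and> (\<forall>a. x a = 0)" for x
      by (auto simp: avoiding_def Z_iff Fac_def)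
    then have "avoiding (unit_vec ` A) t = (if t = 0 then {0} else {})"
      using zero_Fac wt_zero by (auto simp: Z_iff fun_eq_iff wt_def)
    then show "avoid_series (unit_vec ` A) $ t = 1 $ t" by (simp add: avoid_series_def)
  qed
  ultimately show ?thesis by simp
qed

end

section \<open>Rewriting below an element whose Betti elements form a chain\<close>

text \<open>The chain condition is imposed only below \<open>s\<close>, so that it is also available
  when \<open>Betti S\<close> as a whole is not a chain.\<close>

locale betti_chain = numerical_sgp +
  fixes s :: nat
  assumes s_in: "s \<in> S"
    and chain: "\<lbrakk>b \<in> Betti S; c \<in> Betti S; le_S S b s; le_S S c s\<rbrakk> \<Longrightarrow> le_S S b c \<or> le_S S c b"
begin

definition isolated :: "nat \<Rightarrow> (nat \<Rightarrow> nat) \<Rightarrow> bool" where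
  "isolated b x \<longleftrightarrow> (\<forall>y\<in>Z b. y \<noteq> x \<longrightarrow> disjoint_supp x y)"

definition base :: "nat \<Rightarrow> nat \<Rightarrow> nat" where
  "base b = (SOME x. x \<in> Z b \<and> ((\<exists>y\<in>Z b. \<not> isolated b y) \<longrightarrow> \<not> isolated b x))"

text \<open>\<open>base b\<close> is taken in the unique component of the graph of \<open>b\<close> with more than one vertex, if
  there is one; this makes every factorization in \<open>B\<close> an isolated vertex.\<close>

definition B :: "(nat \<Rightarrow> nat) set" where
  "B = {\<beta>. \<exists>b\<in>Betti S. le_S S b s \<and> \<beta> \<in> Z b \<and> \<not> con b \<beta> (base b)}"

lemma base:
  assumes "b \<in> S"
  shows "base b \<in> Z b" "y \<in> Z b \<Longrightarrow> \<not> isolated b y \<Longrightarrow> \<not> isolated b (base b)"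
proof -
  have "\<exists>x. x \<in> Z b \<and> ((\<exists>y\<in>Z b. \<not> isolated b y) \<longrightarrow> \<not> isolated b x)"
    using Z_nonempty[OF assms] by blast
  from someI_ex[OF this] have "base b \<in> Z b \<and> ((\<exists>y\<in>Z b. \<not> isolated b y) \<longrightarrow> \<not> isolated b (base b))"
    unfolding base_def .
  then show "base b \<in> Z b" "y \<in> Z b \<Longrightarrow> \<not> isolated b y \<Longrightarrow> \<not> isolated b (base b)"
    by blast+
qed

lemma BD:
  assumes "\<beta> \<in> B"
  shows "wt \<beta> \<in> Betti S" "le_S S (wt \<beta>) s" "\<beta> \<in> Fac" "\<beta> \<in> Z (wt \<beta>)" "\<not> con (wt \<beta>) \<beta> (base (wt \<beta>))"
    "wt \<beta> \<in> S" "\<beta> \<noteq> base (wt \<beta>)" "base (wt \<beta>) \<in> Z (wt \<beta>)"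
  using assms base by (auto simp: B_def Z_iff Betti_def)

text \<open>A non-isolated factorization of \<open>b\<close> is connected to one that contains a factorization of a
  smaller Betti element; comparability of these Betti elements merges the components.\<close>

lemma nonisolated_connected:
  assumes b: "b \<in> Betti S" "le_S S b s" and x: "x \<in> Z b" "\<not> isolated b x" and y: "y \<in> Z b" "\<not> isolated b y"
  shows "con b x y"
proof -
  \<comment> \<open>Only the shared generator \<open>a\<close> is kept: the rest of \<open>x\<close>
    may be exchanged for any factorization through a Betti element \<open>c\<close>. The free choice
    of \<open>z\<close> is what later links \<open>x\<close> and \<open>y\<close>.\<close>
  have split: "\<exists>a c v. a \<in> A \<and> b = c + v + a \<and> c \<in> Betti S \<and> v \<in> S \<and> (\<forall>z\<in>Z c. \<forall>w\<in>Z v. con b x (z + w + unit_vec a))"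
    if x: "x \<in> Z b" "\<not> isolated b x" for x
  proof -
    obtain x' where x': "x' \<in> Z b" "x' \<noteq> x" "\<not> disjoint_supp x x'"
      using x(2) by (auto simp: isolated_def)
    obtain a t p p' where *: "b = t + a" "x = p + unit_vec a" "x' = p' + unit_vec a" "p \<in> Z t" "p' \<in> Z t" "a \<in> A"
      using split_shared[OF x(1) x'(1,3)] by metis
    obtain c where c: "c \<in> Betti S" "le_S S c t"
      using Betti_below[OF *(4,5)] * x'(2) by blast
    then obtain v where v: "v \<in> S" "t = c + v" by (auto simp: le_S_def)
    have "con b x (z + w + unit_vec a)" if "z \<in> Z c" "w \<in> Z v" for z w
    proof (rule con_share[OF x(1)])
      show "z + w + unit_vec a \<in> Z b"
        using *(1,6) v(2) that by (auto simp: Z_iff wt_add Fac_add_iff wt_unit_vec unit_vec_Fac)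
      show "\<not> disjoint_supp x (z + w + unit_vec a)"
        unfolding disjoint_supp_def *(2) by (auto simp: unit_vec_def intro!: exI[of _ a])
    qed
    then show ?thesis using * c v by blast
  qed
  obtain a c v where 1: "a \<in> A" "b = c + v + a" "c \<in> Betti S" "v \<in> S"
    "\<And>z w. z \<in> Z c \<Longrightarrow> w \<in> Z v \<Longrightarrow> con b x (z + w + unit_vec a)" using split[OF x] by blast
  obtain a' c' v' where 2: "a' \<in> A" "b = c' + v' + a'" "c' \<in> Betti S" "v' \<in> S"
    "\<And>z w. z \<in> Z c' \<Longrightarrow> w \<in> Z v' \<Longrightarrow> con b y (z + w + unit_vec a')" using split[OF y] by blast
  have "le_S S c b"
    unfolding 1(2) add.assoc by (intro le_S_add add_in 1(4) A_subset 1(1))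
  moreover have "le_S S c' b"
    unfolding 2(2) add.assoc by (intro le_S_add add_in 2(4) A_subset 2(1))
  ultimately have le: "le_S S c c' \<or> le_S S c' c" using chain 1(3) 2(3) b(2) le_S_trans by blast
  obtain w w' where w: "w \<in> Z v" "w' \<in> Z v'" using Z_nonempty[OF 1(4)] Z_nonempty[OF 2(4)] by blast
  have meet: "\<exists>z\<in>Z c. \<exists>z'\<in>Z c'. \<not> disjoint_supp z z'"
  proof -
    \<comment> \<open>A factorization of the smaller Betti element extends to one of the larger, and
      it is nonzero.\<close>
    have aux: "\<exists>z\<in>Z c. \<exists>z'\<in>Z c'. \<not> disjoint_supp z z'"
      if c: "c \<in> Betti S" and le: "le_S S c c'" for c c'
    proof -
      obtain u where u: "u \<in> S" "c' = c + u" using le by (auto simp: le_S_def)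
      obtain z q where z: "z \<in> Z c" "q \<in> Z u" using Z_nonempty[OF u(1)] Z_nonempty[of c] c unfolding Betti_def by blast
      have "z \<noteq> 0" using z Betti_pos[OF c] wt_zero by (auto simp: Z_iff)
      then have "\<not> disjoint_supp z (z + q)" by (auto simp: disjoint_supp_def fun_eq_iff)
      then show ?thesis using z u Z_add by blast
    qed
    show ?thesis using le aux[OF 1(3)] aux[OF 2(3)] disjoint_supp_sym by metis
  qed
  then obtain z z' where z: "z \<in> Z c" "z' \<in> Z c'" "\<not> disjoint_supp z z'" by blast
  have "con b x (z + w + unit_vec a)" "con b y (z' + w' + unit_vec a')" using 1(5)[OF z(1) w(1)] 2(5)[OF z(2) w(2)] by blast+
  moreover have "con b (z + w + unit_vec a) (z' + w' + unit_vec a')"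
  proof (rule con_share)
    show "z + w + unit_vec a \<in> Z b" "z' + w' + unit_vec a' \<in> Z b"
      using calculation con_Z x(1) y(1) by blast+
    show "\<not> disjoint_supp (z + w + unit_vec a) (z' + w' + unit_vec a')"
      using z(3) by (auto simp: disjoint_supp_def)
  qed
  ultimately show ?thesis using con_sym by (meson rtranclp_trans)
qed

text \<open>Otherwise the base would be non-isolated too, hence in the component of
  \<open>\<beta>\<close>.\<close>

lemma B_isolated: "\<beta> \<in> B \<Longrightarrow> isolated (wt \<beta>) \<beta>"
  using BD[of \<beta>] base[of "wt \<beta>"] nonisolated_connected[of "wt \<beta>" \<beta> "base (wt \<beta>)"] by blast

text \<open>For \<open>b\<close> strictly below, extend \<open>z\<close> by a nonzero
  \<open>v\<close> to degree \<open>wt \<beta>\<close>. Then \<open>z + v\<close> shares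
  \<open>v\<close> with \<open>p + v\<close> for another \<open>p\<close> in \<open>Z b\<close>, so
  it is not the isolated vertex \<open>\<beta>\<close> and is disjoint from it.\<close>

lemma B_disjoint_Z:
  assumes \<beta>: "\<beta> \<in> B" and b: "b \<in> Betti S" "le_S S b (wt \<beta>)" and z: "z \<in> Z b" "z \<noteq> \<beta>"
  shows "disjoint_supp \<beta> z"
proof (cases "b = wt \<beta>")
  case True
  then show ?thesis using B_isolated[OF \<beta>] z by (auto simp: isolated_def)
next
  case False
  obtain u where u: "u \<in> S" "wt \<beta> = b + u" using b by (auto simp: le_S_def)
  obtain v where v: "v \<in> Z u" using Z_nonempty u by blast
  obtain x y where xy: "x \<in> Z b" "y \<in> Z b" "x \<noteq> y" using Betti_two[OF b(1)] by metis
  have "v \<noteq> 0" using v u False wt_zero by (auto simp: Z_iff)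
  then have v': "\<not> disjoint_supp (p + v) (q + v)" for p q
    by (auto simp: disjoint_supp_def fun_eq_iff)
  have Zv: "p \<in> Z b \<Longrightarrow> p + v \<in> Z (wt \<beta>)" for p using v u Z_add by simp
  have "z + v \<noteq> \<beta>"
  proof
    assume eq: "z + v = \<beta>"
    obtain p where p: "p \<in> Z b" "p \<noteq> z" using xy by metis
    then show False
      using B_isolated[OF \<beta>] v'[of z p] Zv[OF p(1)] eq unfolding isolated_def by fastforce
  qed
  then have "disjoint_supp \<beta> (z + v)"
    using B_isolated[OF \<beta>] Zv[OF z(1)] by (auto simp: isolated_def)
  then show ?thesis by (auto simp: disjoint_supp_def)
qed

lemma B_disjoint:
  assumes "\<beta> \<in> B" "\<beta>' \<in> B" "\<beta> \<noteq> \<beta>'"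
  shows "disjoint_supp \<beta> \<beta>'"
  using chain[of "wt \<beta>" "wt \<beta>'"] BD[OF assms(1)] BD[OF assms(2)] B_disjoint_Z[OF assms(1), of "wt \<beta>'" \<beta>']
    B_disjoint_Z[OF assms(2), of "wt \<beta>" \<beta>] assms(3) disjoint_supp_sym by metis

lemma finite_B: "finite B"
proof (rule finite_subset)
  show "B \<subseteq> (\<Union>b\<in>{..s}. Z b)"
    by (auto simp: B_def dest: le_S_imp_le)
qed (simp add: finite_Z)

section \<open>Confluence and termination of the rewriting\<close>

definition rew :: "(nat \<Rightarrow> nat) \<Rightarrow> (nat \<Rightarrow> nat) \<Rightarrow> bool" where
  "rew x y \<longleftrightarrow> (\<exists>\<beta>\<in>B. \<exists>v. x = v + \<beta> \<and> y = v + base (wt \<beta>))"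

text \<open>Two different members of \<open>B\<close> occur in \<open>x\<close> at disjoint places,
  so each replacement remains possible after the other.\<close>

lemma confluentp_rew: "confluentp rew"
proof (rule strong_confluentp_imp_confluentp, rule strong_confluentpI)
  fix x y z assume "rew x y" "rew x z"
  then obtain \<beta> \<beta>' v w where *: "\<beta> \<in> B" "\<beta>' \<in> B" "x = v + \<beta>" "y = v + base (wt \<beta>)"
    "x = w + \<beta>'" "z = w + base (wt \<beta>')" unfolding rew_def by blast
  show "\<exists>u. rew\<^sup>*\<^sup>* y u \<and> rew\<^sup>=\<^sup>= z u"
  proof (cases "\<beta> = \<beta>'")
    case True
    then have "y = z" using * by simp
    then show ?thesis by blast
  next
    case False
    then have "disjoint_supp \<beta> \<beta>'" using * B_disjoint by blast
    then obtain u where u: "v = u + \<beta>'" "w = u + \<beta>" using disjoint_supp_add * by metis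
    let ?u = "u + base (wt \<beta>) + base (wt \<beta>')"
    have "y = (u + base (wt \<beta>)) + \<beta>'" "z = (u + base (wt \<beta>')) + \<beta>"
      "?u = (u + base (wt \<beta>')) + base (wt \<beta>)" using * u by (simp_all add: ac_simps)
    then have "rew y ?u" "rew z ?u" using * unfolding rew_def by metis+
    then show ?thesis by blast
  qed
qed

lemma rew_add: "rew x y \<Longrightarrow> rew (x + w) (y + w)"
  unfolding rew_def by (metis add.assoc add.commute)

lemma rews_add: "rew\<^sup>*\<^sup>* x y \<Longrightarrow> rew\<^sup>*\<^sup>* (x + w) (y + w)"
proof (induction rule: rtranclp_induct)
  case (step y z)
  show ?case
    using step.IH rew_add[OF step.hyps(2), of w] by (rule rtranclp.rtrancl_into_rtrancl[of rew "x + w" "y + w" "z + w"])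
qed simp

definition joinable :: "(nat \<Rightarrow> nat) \<Rightarrow> (nat \<Rightarrow> nat) \<Rightarrow> bool" where
  "joinable x y \<longleftrightarrow> (\<exists>u. rew\<^sup>*\<^sup>* x u \<and> rew\<^sup>*\<^sup>* y u)"

lemma joinable_trans: "joinable x y \<Longrightarrow> joinable y z \<Longrightarrow> joinable x z"
  unfolding joinable_def using confluentpD[OF confluentp_rew] by (meson rtranclp_trans)

lemma joinable_sym: "joinable x y \<Longrightarrow> joinable y x"
  by (auto simp: joinable_def)

lemma joinable_add: "joinable x y \<Longrightarrow> joinable (x + w) (y + w)"
  using rews_add by (auto simp: joinable_def)

text \<open>Along an edge, cancel a shared generator and use induction on the degree. In a Betti
  degree, whatever is not connected to the base belongs to \<open>B\<close> and rewrites to the base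
  in one step.\<close>

lemma Z_joinable:
  assumes "le_S S t s" "x \<in> Z t" "y \<in> Z t"
  shows "joinable x y"
  using assms
proof (induction t arbitrary: x y rule: less_induct)
  case (less t)
  have adj: "joinable x y" if "nabla_adj S t x y" for x y
  proof -
    have "x \<in> Z t" "y \<in> Z t" "\<not> disjoint_supp x y" using that by (auto simp: nabla_adj_iff)
    then obtain a t' x' y' where *: "t = t' + a" "x = x' + unit_vec a" "y = y' + unit_vec a"
      "x' \<in> Z t'" "y' \<in> Z t'" "a \<in> A" "t' < t" by (rule split_shared)
    have "le_S S t' s" using *(1,6) less.prems(1) A_subset le_S_add le_S_trans by blast
    then show ?thesis using less.IH[OF *(7) _ *(4,5)] joinable_add *(2,3) by blast
  qed
  have con: "joinable x y" if "con t x y" for x y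
    using that by (induction rule: rtranclp_induct)
      (auto intro: adj joinable_trans simp: joinable_def[of x x])
  show ?case
  proof (cases "t \<in> Betti S")
    case False
    then show ?thesis using con less.prems Z_in_S by (auto simp: Betti_def nabla_connected_def)
  next
    case True
    have "joinable z (base t)" if z: "z \<in> Z t" for z
    proof (cases "con t z (base t)")
      case False
      then have "z \<in> B" using z True less.prems by (auto simp: B_def)
      then have "rew z (base t)" using z unfolding rew_def by (metis Z_iff add.left_neutral)
      then show ?thesis by (auto simp: joinable_def)
    qed (rule con)
    then show ?thesis using less.prems joinable_trans joinable_sym by blast
  qed
qed

text \<open>\<open>base (wt \<beta>)\<close> only involves generators occurring in members of \<open>B\<close> of degree less than
  \<open>wt \<beta>\<close>, and at most \<open>s\<close> of them with
  multiplicity.\<close>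

definition weight :: "nat \<Rightarrow> nat" where
  "weight a = (\<Sum>\<beta>\<in>{\<beta>\<in>B. \<beta> a \<noteq> 0}. Suc s ^ wt \<beta>)"

definition measure_rew :: "(nat \<Rightarrow> nat) \<Rightarrow> nat" where
  "measure_rew x = (\<Sum>a\<in>A. x a * weight a)"

lemma measure_rew_add: "measure_rew (x + y) = measure_rew x + measure_rew y"
  by (simp add: measure_rew_def sum.distrib algebra_simps)

text \<open>With \<open>b = wt \<beta>\<close>, every generator in the base weighs at most
  \<open>(s+1)^(b-1)\<close>, and their multiplicities sum to at most \<open>b \<le> s\<close>. The
  total stays below \<open>(s+1)^b\<close>, which a single generator of \<open>\<beta>\<close>
  already reaches.\<close>

lemma measure_rew_base:
  assumes \<beta>: "\<beta> \<in> B"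
  shows "measure_rew (base (wt \<beta>)) < measure_rew \<beta>"
proof -
  let ?b = "wt \<beta>" and ?r = "base (wt \<beta>)"
  have "0 < ?b" "?b \<le> s" using BD[OF \<beta>] Betti_pos le_S_imp_le by auto
  then obtain m where m: "?b = Suc m" by (cases ?b) auto
  have "weight a \<le> Suc s ^ m" if a: "?r a \<noteq> 0" for a
  proof -
    \<comment> \<open>A member of \<open>B\<close> of degree above or equal to \<open>?b\<close>
      would be disjoint from the base; the chain condition leaves only smaller degrees.\<close>
    have lt: "wt \<beta>' < ?b" if \<beta>': "\<beta>' \<in> B" "\<beta>' a \<noteq> 0" for \<beta>'
    proof -
      have nd: "\<not> disjoint_supp \<beta>' ?r" using a \<beta>' by (auto simp: disjoint_supp_def)
      have "\<not> le_S S ?b (wt \<beta>')"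
      proof
        assume le: "le_S S ?b (wt \<beta>')"
        have "?r \<noteq> \<beta>'" using BD(8)[OF \<beta>] BD(7)[OF \<beta>'(1)] by (auto simp: Z_iff)
        then show False
          using B_disjoint_Z[OF \<beta>'(1) BD(1)[OF \<beta>] le BD(8)[OF \<beta>]] nd by blast
      qed
      then show ?thesis
        using chain[of "wt \<beta>'" ?b] BD[OF \<beta>] BD[OF \<beta>'(1)] le_S_imp_le le_S_refl
        by (metis le_neq_implies_less)
    qed
    have one: "\<beta>' = \<beta>''" if "\<beta>' \<in> B" "\<beta>' a \<noteq> 0" "\<beta>'' \<in> B" "\<beta>'' a \<noteq> 0" for \<beta>' \<beta>''
      using B_disjoint[OF that(1,3)] that(2,4) unfolding disjoint_supp_def by metis
    show ?thesis
    proof (cases "\<exists>\<beta>'\<in>B. \<beta>' a \<noteq> 0")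
      case True
      then obtain \<beta>' where \<beta>': "\<beta>' \<in> B" "\<beta>' a \<noteq> 0" by blast
      then have "{\<beta>\<in>B. \<beta> a \<noteq> 0} = {\<beta>'}" using one by blast
      then have "weight a = Suc s ^ wt \<beta>'" by (simp add: weight_def)
      also have "\<dots> \<le> Suc s ^ m" using lt[OF \<beta>'] m by (intro power_increasing) auto
      finally show ?thesis .
    next
      case False
      then have none: "{\<beta>\<in>B. \<beta> a \<noteq> 0} = {}" by blast
      show ?thesis unfolding weight_def none by simp
    qed
  qed
  \<comment> \<open>The extra factor \<open>a\<close> makes the sum over the generators equal to the
    degree of the base.\<close>
  then have "?r a * weight a \<le> (?r a * a) * Suc s ^ m" if "a \<in> A" for a
  proof (cases "?r a = 0")
    case False
    have "?r a * weight a \<le> ?r a * Suc s ^ m"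
      using \<open>\<And>a. ?r a \<noteq> 0 \<Longrightarrow> weight a \<le> Suc s ^ m\<close>[OF False] by (rule mult_le_mono2)
    also have "\<dots> \<le> (?r a * a) * Suc s ^ m"
      using A_pos[OF that] by (intro mult_le_mono1) simp
    finally show ?thesis .
  qed simp
  then have "measure_rew ?r \<le> (\<Sum>a\<in>A. (?r a * a) * Suc s ^ m)"
    unfolding measure_rew_def by (rule sum_mono)
  also have "\<dots> = ?b * Suc s ^ m"
    using BD(8)[OF \<beta>] by (simp only: sum_distrib_right[symmetric]) (simp add: Z_iff wt_def)
  also have "\<dots> < Suc s ^ ?b" using \<open>?b \<le> s\<close> m by simp
  also have "\<dots> \<le> measure_rew \<beta>"
  proof -
    have "\<beta> \<noteq> 0" using \<open>0 < ?b\<close> wt_zero by auto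
    then obtain a where a: "\<beta> a \<noteq> 0" by (auto simp: fun_eq_iff)
    then have "a \<in> A" using BD(3)[OF \<beta>] by (auto simp: Fac_def)
    have "Suc s ^ ?b \<le> weight a"
      unfolding weight_def using \<beta> a finite_B by (intro member_le_sum) auto
    also have "\<dots> \<le> \<beta> a * weight a" using a by simp
    also have "\<dots> \<le> measure_rew \<beta>"
      unfolding measure_rew_def using \<open>a \<in> A\<close> finite_A by (intro member_le_sum) auto
    finally show ?thesis .
  qed
  finally show ?thesis .
qed

lemma rew_Z: "rew x y \<Longrightarrow> x \<in> Z t \<Longrightarrow> y \<in> Z t"
  using BD(8) by (fastforce simp: rew_def Z_iff wt_add Fac_add_iff)

lemma avoiding_iff: "x \<in> avoiding B t \<longleftrightarrow> x \<in> Z t \<and> (\<forall>y. \<not> rew x y)"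
  by (auto simp: avoiding_def rew_def le_fun_iff_add)

lemma avoiding_nonempty: "x \<in> Z t \<Longrightarrow> \<exists>y. y \<in> avoiding B t"
proof (induction "measure_rew x" arbitrary: x rule: less_induct)
  case less
  show ?case
  proof (cases "\<exists>y. rew x y")
    case True
    then obtain y where y: "rew x y" by blast
    then have "measure_rew y < measure_rew x"
      using measure_rew_base by (auto simp: rew_def measure_rew_add)
    then show ?thesis using less.hyps rew_Z[OF y less.prems] by blast
  qed (use less.prems avoiding_iff in blast)
qed

text \<open>The avoiding factorizations are the normal forms: termination gives one, and joinable
  normal forms coincide.\<close>

lemma card_avoiding:
  assumes "t \<in> S" "le_S S t s"
  shows "card (avoiding B t) = 1"
proof -
  have "x = y" if "x \<in> avoiding B t" "y \<in> avoiding B t" for x y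
  proof -
    have "joinable x y" using that Z_joinable[OF assms(2)] by (auto simp: avoiding_iff)
    then show ?thesis
      using that unfolding joinable_def avoiding_iff by (metis converse_rtranclpE)
  qed
  moreover obtain x where "x \<in> avoiding B t"
    using avoiding_nonempty Z_nonempty[OF assms(1)] by blast
  ultimately have "avoiding B t = {x}" by blast
  then show ?thesis by simp
qed

end

section \<open>Cyclotomic exponents\<close>

context numerical_sgp
begin

lemma hilb_nth: "hilb S $ n = (if n \<in> S then 1 else 0)"
  by (simp add: hilb_def)

text \<open>Unique existence of the exponents makes the definite description in
  \<open>cyc_exp\<close> meaningful.\<close>

lemma cyc_exp: "\<forall>k\<le>n. ((1 - fps_X) * hilb S) $ k = tprod (cyc_exp S) n $ k"
proof -
  let ?F = "(1 - fps_X) * hilb S"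
  have "?F $ 0 = 1" by (simp add: hilb_nth zero_in)
  moreover have "?F $ k \<in> \<int>" for k
    by (simp add: left_diff_distrib hilb_nth)
  ultimately have "\<exists>!e. e 0 = 0 \<and> (\<forall>n. \<forall>k\<le>n. ?F $ k = tprod e n $ k)"
    by (rule tprod_exponents_ex1)
  moreover have "is_cyc_exp S e \<longleftrightarrow> e 0 = 0 \<and> (\<forall>n. \<forall>k\<le>n. ?F $ k = tprod e n $ k)" for e
    by (simp add: is_cyc_exp_def tprod_def)
  ultimately have "\<exists>!e. is_cyc_exp S e" by simp
  from theI'[OF this] show ?thesis
    unfolding cyc_exp_def[symmetric] by (simp add: is_cyc_exp_def tprod_def)
qed

end

context betti_chain
begin

text \<open>An ideal of \<open>S\<close>; outside it the Hilbert series and the avoiding series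
  agree.\<close>

definition above :: "nat set" where
  "above = {t \<in> S. \<not> le_S S t s}"

definition mult :: "nat \<Rightarrow> nat" where
  "mult j = card {\<beta>\<in>B. wt \<beta> = j}"

lemma above_add: "t \<in> above \<Longrightarrow> u \<in> S \<Longrightarrow> t + u \<in> above"
  using le_S_add le_S_trans add_in unfolding above_def by blast

lemma avoid_series_nth_eq_hilb:
  assumes "t \<notin> above"
  shows "avoid_series B $ t = hilb S $ t"
proof (cases "t \<in> S")
  case True
  then show ?thesis using assms card_avoiding by (simp add: above_def avoid_series_def hilb_nth)
next
  case False
  then have "avoiding B t = {}" using Z_in_S by (auto simp: avoiding_def)
  then show ?thesis using False by (simp add: avoid_series_def hilb_nth)
qed

text \<open>With the avoiding series in place of \<open>hilb S\<close> the product is exactly 1. The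
  difference of the two series is supported in the ideal \<open>above\<close>, and \<open>P\<close>
  has its degrees in \<open>S\<close>, so the error stays in the ideal.\<close>

lemma quotient_one_plus:
  defines "P \<equiv> (\<Prod>a\<in>A. 1 - fps_X ^ a) * inverse (\<Prod>\<beta>\<in>B. 1 - fps_X ^ wt \<beta>)"
  shows "hilb S * P \<in> one_plus above"
proof -
  define E :: "rat fps" where "E = (\<Prod>\<beta>\<in>B. 1 - fps_X ^ wt \<beta>)"
  have E: "E \<in> one_plus S"
    unfolding E_def using BD Betti_pos
    by (intro one_plus_prod add_in one_minus_X_power_one_plus) auto
  then have E_inv: "E * inverse E = 1"
    by (intro inverse_mult_eq_1') (simp add: one_plus_nth_0)
  have P: "P \<in> one_plus S"
    unfolding P_def E_def[symmetric] using A_subset A_pos E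
    by (intro one_plus_mult one_plus_inverse one_plus_prod add_in one_minus_X_power_one_plus) auto
  have "avoid_series B * P = (avoid_series {} * (\<Prod>a\<in>A. 1 - fps_X ^ a)) * (E * inverse E)"
    unfolding P_def E_def[symmetric]
    using avoid_series_prod[OF finite_B _ B_disjoint] BD(3) by (simp add: E_def subset_iff ac_simps)
  then have VP: "avoid_series B * P = 1" by (simp only: avoid_series_gens E_inv mult_1)
  define Q where "Q = (hilb S - avoid_series B) * P"
  have HP: "hilb S * P = 1 + Q"
    unfolding Q_def left_diff_distrib VP by simp
  have Q: "k \<in> above" if Qk: "Q $ k \<noteq> 0" for k
  proof -
    obtain i where i: "i \<le> k" "(hilb S - avoid_series B) $ i \<noteq> 0" "P $ (k - i) \<noteq> 0"
      using Qk unfolding Q_def by (rule fps_mult_nth_nonzeroE)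
    then have "i \<in> above" using avoid_series_nth_eq_hilb[of i] by auto
    moreover have "k - i \<in> S" using i one_plusD[OF P, of "k - i"] zero_in by (cases "k - i = 0") auto
    ultimately show ?thesis using above_add[of i "k - i"] i(1) by simp
  qed
  have "0 \<notin> above" using s_in by (auto simp: above_def le_S_def)
  then have "Q $ 0 = 0" using Q by blast
  then show ?thesis using Q unfolding HP one_plus_def by auto
qed

lemma cyc_exp_eq_mult:
  assumes j: "2 \<le> j" "j \<notin> A" "j \<notin> above"
  shows "cyc_exp S j = int (mult j)"
proof -
  define D :: "rat fps" where "D = (\<Prod>a\<in>A. 1 - fps_X ^ a)"
  define E :: "rat fps" where "E = (\<Prod>\<beta>\<in>B. 1 - fps_X ^ wt \<beta>)"
  define F where "F = (1 - fps_X) * hilb S"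
  define G where "G = hilb S * (D * inverse E)"
  define e where "e = cyc_exp S"
  define a where "a i = (if i \<in> A then 1 else 0 :: int)" for i
  define d where "d i = (if i = 1 then 1 else 0 :: int)" for i :: nat
  \<comment> \<open>The exponents of \<open>G\<close>: \<open>e\<close> stands for
    \<open>(1 - X) hilb S\<close>, \<open>a\<close> for the numerator \<open>D\<close>, while
    \<open>d\<close> removes the factor \<open>1 - X\<close> and \<open>mult\<close> accounts for
    \<open>1 / E\<close>.\<close>
  define g where "g i = e i + a i - (d i + int (mult i))" for i
  have G: "G \<in> one_plus above"
    unfolding G_def D_def E_def by (rule quotient_one_plus)
  obtain c where c: "\<And>a. a \<in> A \<Longrightarrow> a \<le> c"
    using finite_A unfolding finite_nat_set_iff_bounded_le by blast
  \<comment> \<open>Large enough to include every factor of \<open>D\<close> and \<open>E\<close>,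
    so only the product for \<open>F\<close> is truncated.\<close>
  define n where "n = j + c + s"
  have B_le: "wt \<beta> \<in> {1..n}" if "\<beta> \<in> B" for \<beta>
    using le_S_imp_le[OF BD(2)[OF that]] Betti_pos[OF BD(1)[OF that]] by (simp add: n_def)
  have tD: "tprod a n = D"
    unfolding tprod_def D_def
  proof (rule prod.mono_neutral_cong_right)
    show "A \<subseteq> {1..n}"
    proof
      fix x assume "x \<in> A"
      then show "x \<in> {1..n}" using c[of x] A_pos[of x] by (simp add: n_def)
    qed
  qed (auto simp: a_def)
  have td: "tprod d n = 1 - fps_X"
  proof -
    have "tprod d n = (\<Prod>j\<in>{1}. 1 - fps_X ^ j)"
      unfolding tprod_def using j by (intro prod.mono_neutral_cong_right) (auto simp: d_def n_def)
    then show ?thesis by simp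
  qed
  have tE: "tprod (\<lambda>i. int (mult i)) n = E"
  proof -
    have "E = (\<Prod>i\<in>{1..n}. \<Prod>\<beta>\<in>{\<beta>\<in>B. wt \<beta> = i}. 1 - fps_X ^ wt \<beta>)"
      unfolding E_def using B_le by (intro prod.group[symmetric] finite_B) auto
    also have "\<dots> = tprod (\<lambda>i. int (mult i)) n"
      unfolding tprod_def by (intro prod.cong) (auto simp: mult_def)
    finally show ?thesis by simp
  qed
  have E0: "E $ 0 = 1"
    using tprod_nth_0[of "\<lambda>i. int (mult i)" n] tE by simp
  have E_inv: "E * inverse E = 1" by (intro inverse_mult_eq_1') (simp add: E0)
  have "tprod g n * ((1 - fps_X) * E) = tprod (\<lambda>i. g i + (d i + int (mult i))) n"
    by (simp only: tprod_add td tE)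
  also have "\<dots> = tprod (\<lambda>i. e i + a i) n" by (simp add: g_def)
  also have "\<dots> = tprod e n * D" by (simp only: tprod_add tD)
  finally have 1: "tprod g n * ((1 - fps_X) * E) = tprod e n * D" .
  have 2: "G * ((1 - fps_X) * E) = F * D"
  proof -
    have "G * ((1 - fps_X) * E) = F * D * (E * inverse E)" by (simp only: G_def F_def ac_simps)
    then show ?thesis by (simp only: E_inv mult_1_right)
  qed
  \<comment> \<open>The comparison modulo \<open>X^(n+1)\<close> is made after clearing
    denominators; the unit \<open>(1 - X) E\<close> is then cancelled.\<close>
  have "fps_X ^ Suc n dvd (tprod e n - F)"
    unfolding X_power_dvd_iff using cyc_exp[of n] by (simp add: e_def F_def)
  moreover have "(tprod g n - G) * ((1 - fps_X) * E) = (tprod e n - F) * D"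
    by (simp only: left_diff_distrib[of _ _ "(1 - fps_X) * E"] left_diff_distrib[of _ _ D] 1 2)
  ultimately have "fps_X ^ Suc n dvd (tprod g n - G) * ((1 - fps_X) * E)"
    by (metis dvd_mult2)
  moreover have "(1 - fps_X) * E dvd 1" by (simp add: E0)
  ultimately have "fps_X ^ Suc n dvd (tprod g n - G)"
    by (simp only: dvd_mult_unit_iff)
  then have "tprod g n $ k = G $ k" if "k \<le> n" for k
    unfolding X_power_dvd_iff using that by simp
  moreover have "x + y \<in> above" if "x \<in> above" "y \<in> above" for x y
    using above_add[of x y] that by (simp add: above_def)
  ultimately have "g j \<noteq> 0 \<Longrightarrow> j \<in> above"
    using j by (intro tprod_exponents_in[OF _ G, of n g j]) (auto simp: n_def)
  then have "g j = 0" using j by blast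
  then show ?thesis using j by (simp add: g_def a_def d_def e_def)
qed

text \<open>A gap lies outside the ideal and is not the degree of any factorization.\<close>

lemma cyc_exp_gap:
  assumes "2 \<le> j" "j \<notin> S"
  shows "cyc_exp S j = 0"
proof -
  have none: "{\<beta>\<in>B. wt \<beta> = j} = {}" using assms BD(6) by blast
  show ?thesis
    using cyc_exp_eq_mult[of j] assms A_subset by (simp add: above_def mult_def none) blast
qed

lemma cyc_exp_top_iff:
  assumes "2 \<le> s" "s \<notin> A"
  shows "cyc_exp S s \<noteq> 0 \<longleftrightarrow> s \<in> Betti S"
proof -
  have "cyc_exp S s = int (mult s)"
    using assms le_S_refl by (intro cyc_exp_eq_mult) (auto simp: above_def)
  also have "\<dots> \<noteq> 0 \<longleftrightarrow> (\<exists>\<beta>\<in>B. wt \<beta> = s)"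
    using finite_B by (auto simp: mult_def)
  also have "\<dots> \<longleftrightarrow> s \<in> Betti S"
  proof
    assume "s \<in> Betti S"
    then obtain x y where xy: "x \<in> Z s" "y \<in> Z s" "\<not> con s x y" by (rule Betti_two)
    \<comment> \<open>Were both connected to the base, they would be connected to each
      other.\<close>
    then have "\<not> con s x (base s) \<or> \<not> con s y (base s)"
      using con_sym by (meson rtranclp_trans)
    then have "x \<in> B \<or> y \<in> B"
      using xy \<open>s \<in> Betti S\<close> le_S_refl unfolding B_def by blast
    then show "\<exists>\<beta>\<in>B. wt \<beta> = s" using xy by (auto simp: Z_iff)
  qed (use BD in blast)
  finally show ?thesis .
qed

end

section \<open>From single degrees to the three equivalences\<close>

context numerical_sgp
begin

lemma cyc_exp_nonzero_in_S:
  assumes "2 \<le> j" "cyc_exp S j \<noteq> 0"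
  shows "j \<in> S"
proof -
  \<comment> \<open>At \<open>s = 0\<close> the chain condition is vacuous, since Betti elements are
    positive.\<close>
  interpret betti_chain S 0
    by unfold_locales (use zero_in Betti_pos le_S_imp_le in fastforce)+
  show ?thesis using cyc_exp_gap assms by blast
qed

lemma mem_calE_iff_Betti:
  assumes "\<And>b c. \<lbrakk>b \<in> Betti S; c \<in> Betti S; le_S S b s; le_S S c s\<rbrakk> \<Longrightarrow> le_S S b c \<or> le_S S c b"
  shows "s \<in> calE S \<longleftrightarrow> s \<in> Betti S"
proof (cases "s \<in> S \<and> 2 \<le> s \<and> s \<notin> A")
  case True
  then interpret betti_chain S s
    by unfold_locales (use assms in auto)
  show ?thesis using cyc_exp_top_iff True by (simp add: calE_def)
next
  case False
  moreover have "s \<in> Betti S \<Longrightarrow> s \<in> S" by (simp add: Betti_def)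
  ultimately show ?thesis
    using cyc_exp_nonzero_in_S Betti_ge_2 Betti_notin_A by (auto simp: calE_def)
qed

lemma calE_eq_Betti_if_Betti_sorted:
  "totally_ordered_by (le_S S) (Betti S) \<Longrightarrow> calE S = Betti S"
  using mem_calE_iff_Betti unfolding totally_ordered_by_def by blast

lemma Betti_sorted_if_calE_sorted:
  assumes "totally_ordered_by (le_S S) (calE S)"
  shows "totally_ordered_by (le_S S) (Betti S)"
proof -
  have "le_S S b c \<or> le_S S c b" if "b \<in> Betti S" "c \<in> Betti S" for b c
    using that
  proof (induction "max b c" arbitrary: b c rule: less_induct)
    case less
    show ?case
    proof (rule ccontr)
      assume inc: "\<not> (le_S S b c \<or> le_S S c b)"
      have "x \<in> calE S" if x: "x \<in> {b, c}" for x
      proof -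
        \<comment> \<open>Distinct Betti elements below \<open>x\<close>, neither equal to
          \<open>x\<close>, have a smaller maximum and are comparable by induction; thus the local
          criterion applies at \<open>x\<close>.\<close>
        have "le_S S y z \<or> le_S S z y"
          if "y \<in> Betti S" "z \<in> Betti S" "le_S S y x" "le_S S z x" for y z
        proof (cases "y = x \<or> z = x")
          case False
          then have "max y z < x" using that le_S_imp_le[of y x] le_S_imp_le[of z x] by auto
          also have "x \<le> max b c" using x by auto
          finally show ?thesis using less.hyps that by blast
        qed (use that in auto)
        then have "x \<in> calE S \<longleftrightarrow> x \<in> Betti S" by (rule mem_calE_iff_Betti)
        then show ?thesis using x less.prems by blast
      qed
      then show False using inc assms by (auto simp: totally_ordered_by_def)
    qed
  qed
  then show ?thesis by (simp add: totally_ordered_by_def)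
qed

lemma dvd_imp_le_S: "a \<in> S \<Longrightarrow> 0 < b \<Longrightarrow> a dvd b \<Longrightarrow> le_S S a b"
proof -
  assume a: "a \<in> S" "0 < b" "a dvd b"
  then obtain k where "b = a * k" by (auto elim: dvdE)
  then obtain m where "b = a + m * a" using a by (cases k) auto
  moreover have "m * a \<in> S" using a by (induction m) (auto intro: zero_in add_in)
  ultimately show ?thesis using le_S_add by simp
qed

text \<open>Zero is excluded because everything divides it, whereas only 0 is below it in the order
  of \<open>S\<close>.\<close>

lemma dvd_sorted_imp_le_S_sorted:
  assumes "X \<subseteq> S" "0 \<notin> X" "totally_ordered_by (dvd) X"
  shows "totally_ordered_by (le_S S) X"
  using assms dvd_imp_le_S unfolding totally_ordered_by_def by (metis neq0_conv subsetD)

lemma Betti_sorted_iff_calE_sorted: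
  "totally_ordered_by (le_S S) (Betti S) \<longleftrightarrow> totally_ordered_by (le_S S) (calE S)"
  using calE_eq_Betti_if_Betti_sorted Betti_sorted_if_calE_sorted by auto

text \<open>Whichever of the two sets is ordered, they coincide; divisibility chains and singletons
  reduce to this.\<close>

lemma calE_eq_Betti_if_sorted:
  assumes "X = Betti S \<or> X = calE S" "totally_ordered_by (le_S S) X"
  shows "calE S = Betti S"
  using assms calE_eq_Betti_if_Betti_sorted Betti_sorted_if_calE_sorted by blast

lemma Betti_dvd_sorted_iff_calE_dvd_sorted:
  "totally_ordered_by (dvd) (Betti S) \<longleftrightarrow> totally_ordered_by (dvd) (calE S)"
proof -
  have "Betti S \<subseteq> S" "0 \<notin> Betti S" using Betti_pos by (auto simp: Betti_def)
  moreover have "calE S \<subseteq> S" "0 \<notin> calE S" using cyc_exp_nonzero_in_S by (auto simp: calE_def)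
  ultimately show ?thesis
    using calE_eq_Betti_if_sorted dvd_sorted_imp_le_S_sorted by metis
qed

lemma Betti_singleton_iff_calE_singleton: "(\<exists>b. Betti S = {b}) \<longleftrightarrow> (\<exists>d. calE S = {d})"
proof -
  have "totally_ordered_by (le_S S) {b}" for b
    using le_S_refl by (simp add: totally_ordered_by_def)
  then show ?thesis using calE_eq_Betti_if_sorted by metis
qed

end

theorem theorem1p3:
  fixes S :: "nat set"
  assumes "numerical_semigroup S"
  shows "(totally_ordered_by (le_S S) (Betti S) \<longleftrightarrow> totally_ordered_by (le_S S) (calE S))
       \<and> (totally_ordered_by (dvd) (Betti S) \<longleftrightarrow> totally_ordered_by (dvd) (calE S))
       \<and> ((\<exists>b. Betti S = {b}) \<longleftrightarrow> (\<exists>d. calE S = {d}))"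
proof -
  interpret numerical_sgp S using assms by unfold_locales
  show ?thesis
    using Betti_sorted_iff_calE_sorted Betti_dvd_sorted_iff_calE_dvd_sorted
      Betti_singleton_iff_calE_singleton by blast
qed

end
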